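(* Consider the affine lines in $\mathbb{R}^2$ $$Y_0:\ y=0,\qquad L_i:\ y=m_i(x-a_i),\quad i=1,\dots,18,$$ where $\varepsilon$ is a real parameter and $a_1=-\tan(8\pi/18)$, $a_2=-\tan(4\pi/18)$, $a_3=-\tan(6\pi/18)$, $a_4=\tan(7\pi/18)$, $a_5=\tan(\pi/18)$, $a_6=\tan(5\pi/18)$, $a_7=-\tan(5\pi/18)$, $a_8=-\varepsilon$, $a_9=-\tan(2\pi/18)$, $a_{10}=\tan(3\pi/18)$, $a_{11}=-\tan(7\pi/18)$, $a_{12}=-\tan(3\pi/18)$, $a_{13}=\tan(2\pi/18)$, $a_{14}=\tan(4\pi/18)$, $a_{15}=\varepsilon$, $a_{16}=\tan(6\pi/18)$, $a_{17}=-\tan(\pi/18)$, $a_{18}=\tan(8\pi/18)$, and $m_i\in[m_i^\ast-10^{-4},\,m_i^\ast+10^{-4}]$ with $m_1^\ast=-0.18006$, $m_2^\ast=-0.25231$, $m_3^\ast=-0.32584$, $m_4^\ast=-1.74521$, $m_5^\ast=-2.17941$, $m_6^\ast=-2.79557$, $m_7^\ast=-4.59586$, $m_8^\ast=-5.67203$, $m_9^\ast=-7.39905$, $m_{10}^\ast=-23.07892$, $m_{11}^\ast=4.39005$, $m_{12}^\ast=2.90204$, $m_{13}^\ast=1.31845$, $m_{14}^\ast=0.90192$, $m_{15}^\ast=0.84501$, $m_{16}^\ast=0.64068$, $m_{17}^\ast=0.44393$, $m_{18}^\ast=0.15548$. Then for every $\varepsilon\in(0,10^{-4})$ and every choice of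 slopes $m_i$ in these intervals, $\{Y_0,L_1,\dots,L_{18}\}$ is a simple affine arrangement of $19$ straight lines such that: (1) $Y_0$ is the line $y=0$; (2) each $L_i$ has the form $y=m_i(x-a_i)$; (3) $\{a_1,\dots,a_{18}\}=\{\pm\tan(k\pi/18)\mid k=1,\dots,8\}\cup\{-\varepsilon,+\varepsilon\}$, with $\varepsilon<1/36$; (4) $Y_0$ touches exactly $17$ bounded triangular faces of the arrangement; (5) the arrangement has exactly $107$ bounded triangular faces.
   Context: An arrangement of lines is simple if no two lines are parallel and no point lies on more than two of its lines. A line $Y_0$ touches a bounded triangular face if it contains one of the sides of that triangle. *)

theory Defs
  imports "HOL-Analysis.Analysis"
begin

type_synonym plane = "real \<times> real"

definition is_line :: "plane set \<Rightarrow> bool" where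
  "is_line l \<longleftrightarrow> affine l \<and> aff_dim l = 1"

definition line_arrangement :: "plane set set \<Rightarrow> bool" where
  "line_arrangement A \<longleftrightarrow> finite A \<and> (\<forall>l\<in>A. is_line l)"

definition simple_arrangement :: "plane set set \<Rightarrow> bool" where
  "simple_arrangement A \<longleftrightarrow> line_arrangement A
     \<and> (\<forall>l\<in>A. \<forall>l'\<in>A. l \<noteq> l' \<longrightarrow> \<not> affine_parallel l l')
     \<and> (\<forall>p. card {l \<in> A. p \<in> l} \<le> 2)"

definition faces :: "plane set set \<Rightarrow> plane set set" where
  "faces A = components (- \<Union>A)"

text \<open>A face is an open set; it is a triangle if its closure is a non-degenerate closed triangle,
  i.e. a 2-simplex. The sides of the triangle are then the facets of the closure.\<close>

definition bounded_triangular_faces :: "plane set set \<Rightarrow> plane set set" where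
  "bounded_triangular_faces A = {F \<in> faces A. bounded F \<and> 2 simplex closure F}"

definition touches :: "plane set \<Rightarrow> plane set \<Rightarrow> bool" where
  "touches l F \<longleftrightarrow> (\<exists>s. s facet_of closure F \<and> s \<subseteq> l)"

text \<open>The two lists below are indexed from 0, hence the shift: \<open>intercept \<epsilon> i\<close> is $a_i$ and
  \<open>slope_center i\<close> is $m_i^*$ for $i = 1, \dots, 18$.\<close>

definition intercept :: "real \<Rightarrow> nat \<Rightarrow> real" where
  "intercept \<epsilon> i =
    [- tan (8 * pi / 18), - tan (4 * pi / 18), - tan (6 * pi / 18),
     tan (7 * pi / 18), tan (pi / 18), tan (5 * pi / 18),
     - tan (5 * pi / 18), - \<epsilon>, - tan (2 * pi / 18),
     tan (3 * pi / 18), - tan (7 * pi / 18), - tan (3 * pi / 18),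
     tan (2 * pi / 18), tan (4 * pi / 18), \<epsilon>,
     tan (6 * pi / 18), - tan (pi / 18), tan (8 * pi / 18)] ! (i - 1)"

definition slope_center :: "nat \<Rightarrow> real" where
  "slope_center i =
    [- 0.18006, - 0.25231, - 0.32584, - 1.74521, - 2.17941, - 2.79557,
     - 4.59586, - 5.67203, - 7.39905, - 23.07892, 4.39005, 2.90204,
     1.31845, 0.90192, 0.84501, 0.64068, 0.44393, 0.15548] ! (i - 1)"

definition Y0 :: "plane set" where
  "Y0 = {(x, y). y = 0}"

definition L :: "real \<Rightarrow> (nat \<Rightarrow> real) \<Rightarrow> nat \<Rightarrow> plane set" where
  "L \<epsilon> m i = {(x, y). y = m i * (x - intercept \<epsilon> i)}"

definition arrangement :: "real \<Rightarrow> (nat \<Rightarrow> real) \<Rightarrow> plane set set" where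
  "arrangement \<epsilon> m = insert Y0 (L \<epsilon> m ` {1..18})"

end

theory Submission
  imports Defs "HOL-Library.Interval"
begin

text \<open>In a simple arrangement, three lines bound a triangular face iff no fourth line crosses the
  triangle they span, that is, iff on each of the three lines the crossings with the other two are
  consecutive. Hence the triangular faces are determined by the order in which every line meets the
  others, and collecting them line by line counts each triangle three times. For the given
  parameters each of these order relations is the sign of a polynomial in the slopes and offsets,
  and integer interval arithmetic over the whole parameter box decides it. The only exception is the
  triangle of \<open>Y\<^sub>0\<close> with the two lines through \<open>(\<plusminus>\<epsilon>, 0)\<close>, which degenerates as \<open>\<epsilon>\<close> tends to \<open>0\<close>;
  there the sign is read off directly.\<close>

section \<open>Lines, half-planes and faces\<close>

lemma touches_simplex_iff:
  assumes "\<not> affine_dependent C" "2 \<le> card C" "closure F = convex hull C" "convex l"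
  shows "touches l F \<longleftrightarrow> (\<exists>u\<in>C. C - {u} \<subseteq> l)"
  using assms subset_hull[of convex l]
  unfolding touches_def
  by (metis facet_of_convex_hull_affine_independent_alt)

locale line_family =
  fixes I :: "'i set" and s t :: "'i \<Rightarrow> real"
  assumes finite_I: "finite I"
    and inj_slope: "inj_on s I"
begin

definition height :: "'i \<Rightarrow> plane \<Rightarrow> real" where
  "height i z = snd z - (s i * fst z + t i)"

definition line :: "'i \<Rightarrow> plane set" where
  "line i = {z. height i z = 0}"

definition side :: "'i \<Rightarrow> plane \<Rightarrow> plane set" where
  "side i p = {z. 0 < height i z * height i p}"

definition crossing :: "'i \<Rightarrow> 'i \<Rightarrow> real" where
  "crossing i j = (t j - t i) / (s i - s j)"

definition vertex :: "'i \<Rightarrow> 'i \<Rightarrow> plane" where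
  "vertex i j = (crossing i j, s i * crossing i j + t i)"

definition corners :: "'i set \<Rightarrow> plane set" where
  "corners S = {vertex i j | i j. i \<in> S \<and> j \<in> S \<and> i \<noteq> j}"

definition open_triangle :: "'i set \<Rightarrow> plane set" where
  "open_triangle S = interior (convex hull (corners S))"

definition consecutive :: "'i \<Rightarrow> 'i \<Rightarrow> 'i \<Rightarrow> bool" where
  "consecutive i j k \<longleftrightarrow> (\<forall>l\<in>I - {i}. crossing i l \<notin> open_segment (crossing i j) (crossing i k))"

definition empty_triples :: "'i set set" where
  "empty_triples = {S. S \<subseteq> I \<and> card S = 3 \<and>
     (\<forall>i\<in>S. \<forall>j\<in>S - {i}. \<forall>k\<in>S - {i}. consecutive i j k)}"

definition touching :: "plane set \<Rightarrow> 'i set" where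
  "touching F = {i \<in> I. touches (line i) F}"

lemma slope_neq: "i \<in> I \<Longrightarrow> j \<in> I \<Longrightarrow> i \<noteq> j \<Longrightarrow> s i \<noteq> s j"
  using inj_slope by (auto dest: inj_onD)

lemma height_eq_inner: "height i z = (- s i, 1) \<bullet> z - t i"
  by (simp add: height_def inner_prod_def)

lemma height_barycentric:
  assumes "u + v + w = 1"
  shows "height i (u *\<^sub>R a + v *\<^sub>R b + w *\<^sub>R c) = u * height i a + v * height i b + w * height i c"
proof -
  have "t i = (u + v + w) * t i" using assms by simp
  then show ?thesis by (simp add: height_def algebra_simps)
qed

lemma line_eq_hyperplane: "line i = {z. (- s i, 1) \<bullet> z = t i}"
  by (auto simp: line_def height_eq_inner)

lemma is_line_line: "is_line (line i)"
  unfolding is_line_def line_eq_hyperplane by (simp add: affine_hyperplane zero_prod_def)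

lemma affine_line: "affine (line i)"
  using is_line_line by (simp add: is_line_def)

lemma affine_independent_not_subset_line:
  assumes "\<not> affine_dependent C" "2 < card C"
  shows "\<not> C \<subseteq> line i"
proof
  assume "C \<subseteq> line i"
  then have "aff_dim C \<le> 1"
    using aff_dim_subset[of C "line i"] is_line_line[of i] by (simp add: is_line_def)
  then show False using aff_dim_affine_independent[OF assms(1)] assms(2) by simp
qed

lemma closed_line: "closed (line i)"
  unfolding line_eq_hyperplane by (rule closed_hyperplane)

lemma convex_side: "convex (side i p)"
proof -
  have "side i p = {z. (height i p *\<^sub>R (- s i, 1)) \<bullet> z > height i p * t i}"
    by (auto simp: side_def height_eq_inner[of i z for z] algebra_simps simp del: scaleR_Pair)
  then show ?thesis by (simp add: convex_halfspace_gt)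
qed

lemma mem_side_iff:
  "z \<in> side i p \<longleftrightarrow> 0 < height i z \<and> 0 < height i p \<or> height i z < 0 \<and> height i p < 0"
  by (simp add: side_def zero_less_mult_iff)

lemma side_disjoint_line: "side i p \<inter> line i = {}"
  by (auto simp: side_def line_def)

lemma connected_subset_side:
  assumes "connected C" "C \<inter> line i = {}" "p \<in> C"
  shows "C \<subseteq> side i p"
proof
  fix z assume z: "z \<in> C"
  show "z \<in> side i p"
  proof (rule ccontr)
    assume "z \<notin> side i p"
    then consider "(- s i, 1) \<bullet> z \<le> t i" "t i \<le> (- s i, 1) \<bullet> p"
      | "(- s i, 1) \<bullet> p \<le> t i" "t i \<le> (- s i, 1) \<bullet> z"
      by (force simp: mem_side_iff height_eq_inner)
    then have "\<exists>w\<in>C. (- s i, 1) \<bullet> w = t i"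
      using connected_ivt_hyperplane[OF assms(1)] z assms(3) by cases blast+
    then show False using assms(2) by (auto simp: line_eq_hyperplane)
  qed
qed

lemma mem_two_lines_iff:
  assumes "i \<in> I" "j \<in> I" "i \<noteq> j"
  shows "z \<in> line i \<and> z \<in> line j \<longleftrightarrow> z = vertex i j"
proof -
  have "s i * x + t i = s j * x + t j \<longleftrightarrow> x = crossing i j" for x
    using slope_neq[OF assms] by (auto simp: crossing_def field_simps)
  from this[of "fst z"] show ?thesis
    by (cases z) (auto simp: line_def height_def vertex_def)
qed

lemma vertex_commute:
  assumes "i \<in> I" "j \<in> I"
  shows "vertex i j = vertex j i"
  using assms mem_two_lines_iff[of i j "vertex i j"] mem_two_lines_iff[of j i "vertex i j"]
  by (cases "i = j") auto

lemma inj_on_line: "inj_on line I"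
proof (rule inj_onI, rule ccontr)
  fix i j assume ij: "i \<in> I" "j \<in> I" "line i = line j" "i \<noteq> j"
  have "(0, t i) \<in> line i" "(1, s i + t i) \<in> line i" by (simp_all add: line_def height_def)
  then show False using mem_two_lines_iff[OF ij(1,2,4)] ij(3) by (metis prod.inject zero_neq_one)
qed

lemma not_affine_parallel_lines:
  assumes "i \<in> I" "j \<in> I" "i \<noteq> j"
  shows "\<not> affine_parallel (line i) (line j)"
proof
  assume "affine_parallel (line i) (line j)"
  then obtain a where a: "line j = (+) a ` line i" by (auto simp: affine_parallel_def)
  have "(0, t i) \<in> line i" "(1, s i + t i) \<in> line i" by (simp_all add: line_def height_def)
  then have "a + (0, t i) \<in> line j" "a + (1, s i + t i) \<in> line j" using a by auto
  then have "s i = s j" by (simp add: line_def height_def algebra_simps)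
  then show False using slope_neq assms by blast
qed

lemma height_vertex:
  assumes "i \<in> I" "l \<in> I" "i \<noteq> l"
  shows "height l (vertex i j) = (s i - s l) * (crossing i j - crossing i l)"
proof -
  have "(s i - s l) * crossing i l = t l - t i"
    using slope_neq[OF assms] by (simp add: crossing_def)
  then show ?thesis by (simp add: height_def vertex_def algebra_simps)
qed

lemma face_disjoint_line: "F \<in> faces (line ` I) \<Longrightarrow> i \<in> I \<Longrightarrow> F \<inter> line i = {}"
  unfolding faces_def by (drule in_components_subset) auto

lemma face_eq_Inter_sides:
  assumes F: "F \<in> faces (line ` I)" and "p \<in> F"
  shows "F = (\<Inter>i\<in>I. side i p)"
proof
  have "connected F" using F unfolding faces_def by (rule in_components_connected)
  then show "F \<subseteq> (\<Inter>i\<in>I. side i p)"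
    using connected_subset_side face_disjoint_line F \<open>p \<in> F\<close> by blast
  then have "p \<in> (\<Inter>i\<in>I. side i p)" using \<open>p \<in> F\<close> by blast
  moreover have "connected (\<Inter>i\<in>I. side i p)"
    by (intro convex_connected convex_INT convex_side)
  moreover have "(\<Inter>i\<in>I. side i p) \<subseteq> - \<Union>(line ` I)"
    using side_disjoint_line by blast
  ultimately show "(\<Inter>i\<in>I. side i p) \<subseteq> F"
    using F \<open>p \<in> F\<close> unfolding faces_def by (intro components_maximal[of F]) auto
qed

lemma convex_face:
  assumes "F \<in> faces (line ` I)"
  shows "convex F"
proof -
  obtain p where "p \<in> F" using assms in_components_nonempty unfolding faces_def by blast
  then show ?thesis
    using face_eq_Inter_sides[OF assms] convex_INT[of I "\<lambda>i. side i p"] convex_side by metis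
qed

lemma interior_closure_face:
  assumes "F \<in> faces (line ` I)"
  shows "interior (closure F) = F"
proof -
  have "open (- \<Union>(line ` I))"
    using finite_I closed_line by (intro open_Compl closed_UN) auto
  then have "open F" using assms unfolding faces_def by (rule open_components)
  then show ?thesis using assms by (simp add: convex_interior_closure convex_face interior_open)
qed

lemma closure_face_subset:
  assumes "F \<in> faces (line ` I)"
  shows "closure F \<subseteq> F \<union> \<Union>(line ` I)"
  using closedin_component[of F "- \<Union>(line ` I)"] assms
  by (auto simp: faces_def closedin_limpt closure_def)

lemma closed_segment_subset_lines:
  assumes "closed_segment a b \<subseteq> \<Union>(line ` I)" "a \<noteq> b"
  obtains i where "i \<in> I" "{a, b} \<subseteq> line i"
proof -
  have "infinite (closed_segment a b)"
    using uncountable_closed_segment[OF assms(2)] countable_finite by blast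
  moreover have "closed_segment a b = (\<Union>i\<in>I. closed_segment a b \<inter> line i)" using assms(1) by auto
  ultimately obtain i where i: "i \<in> I" "infinite (closed_segment a b \<inter> line i)"
    using finite_I by (metis finite_UN_I)
  then obtain x y where xy: "{x, y} \<subseteq> closed_segment a b \<inter> line i" "x \<noteq> y"
    using infinite_arbitrarily_large[OF i(2), of 2] by (auto simp: card_2_iff)
  have "c \<in> affine hull {x, y}" if "c \<in> closed_segment a b" for c
    using collinear_subset[OF collinear_closed_segment[of a b], of "{x, y, c}"] xy that
    by (simp flip: collinear_3_affine_hull)
  then have "{a, b} \<subseteq> affine hull {x, y}" by simp
  also have "\<dots> \<subseteq> line i" using xy by (intro hull_minimal affine_line) auto
  finally show thesis using i(1) that by blast
qed

lemma face_edge_subset_line: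
  assumes F: "F \<in> faces (line ` I)" and edge: "(convex hull {a, b}) facet_of closure F" and "a \<noteq> b"
  obtains i where "i \<in> I" "{a, b} \<subseteq> line i"
proof -
  have "convex hull {a, b} \<noteq> closure F" using edge facet_of_irrefl by metis
  then have "convex hull {a, b} \<inter> F = {}"
    using face_of_disjoint_interior[of "convex hull {a, b}" "closure F"]
      facet_of_imp_face_of[OF edge]
    by (simp add: interior_closure_face[OF F])
  then have "closed_segment a b \<subseteq> \<Union>(line ` I)"
    using facet_of_imp_subset[OF edge] closure_face_subset[OF F] by (auto simp: segment_convex_hull)
  then show thesis using closed_segment_subset_lines \<open>a \<noteq> b\<close> that by blast
qed

end

section \<open>Triangular faces of a simple arrangement\<close>

locale simple_line_family = line_family +
  assumes inj_crossing: "i \<in> I \<Longrightarrow> inj_on (crossing i) (I - {i})"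
begin

lemma vertex_in_line_iff:
  assumes "i \<in> I" "j \<in> I" "i \<noteq> j" "l \<in> I"
  shows "vertex i j \<in> line l \<longleftrightarrow> l = i \<or> l = j"
proof (cases "l = i")
  case False
  then have "vertex i j \<in> line l \<longleftrightarrow> crossing i j = crossing i l"
    using assms slope_neq[of i l] by (simp add: line_def height_vertex)
  then show ?thesis using assms False inj_crossing[of i] by (auto dest: inj_onD)
qed (use assms mem_two_lines_iff in blast)

lemma simple_arrangement_lines: "simple_arrangement (line ` I)"
proof -
  have "card {l \<in> line ` I. p \<in> l} \<le> 2" for p
  proof (rule ccontr)
    assume "\<not> ?thesis"
    moreover have "{l \<in> line ` I. p \<in> l} = line ` {i \<in> I. p \<in> line i}" by auto
    ultimately have "3 \<le> card {i \<in> I. p \<in> line i}"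
      using card_image_le[of "{i \<in> I. p \<in> line i}" line] finite_I by simp
    then obtain S where "S \<subseteq> {i \<in> I. p \<in> line i}" "card S = 3"
      by (meson obtain_subset_with_card_n)
    then obtain i j k where ijk: "{i, j, k} \<subseteq> {i \<in> I. p \<in> line i}" "i \<noteq> j" "i \<noteq> k" "j \<noteq> k"
      by (auto simp: card_3_iff)
    then have "p = vertex i j" using mem_two_lines_iff[of i j p] by auto
    then show False using ijk vertex_in_line_iff[of i j k] by auto
  qed
  then show ?thesis
    unfolding simple_arrangement_def line_arrangement_def
    using finite_I is_line_line not_affine_parallel_lines by blast
qed

lemma vertex_same_side_iff:
  assumes "i \<in> I" "j \<in> I" "k \<in> I" "l \<in> I" "i \<noteq> j" "i \<noteq> k" "l \<noteq> i" "l \<noteq> j" "l \<noteq> k"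
  shows "vertex i k \<in> side l (vertex i j) \<longleftrightarrow>
    crossing i l \<notin> open_segment (crossing i j) (crossing i k)"
proof -
  have product: "height l (vertex i k) * height l (vertex i j) =
     (s i - s l)\<^sup>2 * ((crossing i k - crossing i l) * (crossing i j - crossing i l))"
    using assms by (simp add: height_vertex power2_eq_square)
  have "0 < (s i - s l)\<^sup>2" using slope_neq[of i l] assms by simp
  then have "vertex i k \<in> side l (vertex i j) \<longleftrightarrow>
     0 < (crossing i k - crossing i l) * (crossing i j - crossing i l)"
    by (simp add: side_def product zero_less_mult_iff[of "(s i - s l)\<^sup>2"])
  moreover have "crossing i j \<noteq> crossing i l" "crossing i k \<noteq> crossing i l"
    using inj_crossing[of i] assms by (auto dest: inj_onD)
  ultimately show ?thesis by (auto simp: zero_less_mult_iff open_segment_eq_real_ivl)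
qed

context
  fixes i j k
  assumes in_I: "i \<in> I" "j \<in> I" "k \<in> I" and distinct: "i \<noteq> j" "i \<noteq> k" "j \<noteq> k"
begin

lemma corners_triple: "corners {i, j, k} = {vertex j k, vertex i k, vertex i j}"
  using vertex_commute[of i j] vertex_commute[of i k] vertex_commute[of j k] in_I distinct
  unfolding corners_def by auto

lemma vertices_distinct:
  "vertex j k \<noteq> vertex i k" "vertex j k \<noteq> vertex i j" "vertex i k \<noteq> vertex i j"
  using vertex_in_line_iff in_I distinct by metis+

lemma card_corners: "card (corners {i, j, k}) = 3"
  by (simp add: corners_triple vertices_distinct)

lemma corners_affine_independent: "\<not> affine_dependent (corners {i, j, k})"
  unfolding corners_triple
proof (rule affine_independent_insert[OF affine_independent_2])
  have "affine hull {vertex i k, vertex i j} \<subseteq> line i"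
    using in_I distinct by (intro hull_minimal affine_line) (simp add: vertex_in_line_iff)
  then show "vertex j k \<notin> affine hull {vertex i k, vertex i j}"
    using vertex_in_line_iff[of j k i] in_I distinct by blast
qed

lemma open_triangle_eq_Int_sides:
  "open_triangle {i, j, k} = side i (vertex j k) \<inter> side j (vertex i k) \<inter> side k (vertex i j)"
proof -
  let ?pt = "\<lambda>x y w. x *\<^sub>R vertex j k + y *\<^sub>R vertex i k + w *\<^sub>R vertex i j"
  have "\<not> collinear {vertex j k, vertex i k, vertex i j}"
    using corners_affine_independent vertices_distinct
    by (simp add: corners_triple collinear_3_eq_affine_dependent)
  then have interior: "open_triangle {i, j, k} =
      {z. \<exists>x y w. 0 < x \<and> 0 < y \<and> 0 < w \<and> x + y + w = 1 \<and> ?pt x y w = z}"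
    unfolding open_triangle_def corners_triple by (rule interior_convex_hull_3_minimal) simp
  have on: "height i (vertex i k) = 0" "height i (vertex i j) = 0" "height j (vertex j k) = 0"
     "height j (vertex i j) = 0" "height k (vertex j k) = 0" "height k (vertex i k) = 0"
    and off: "height i (vertex j k) \<noteq> 0" "height j (vertex i k) \<noteq> 0" "height k (vertex i j) \<noteq> 0"
    using vertex_in_line_iff in_I distinct unfolding line_def by auto
  have "0 < x * b * b \<longleftrightarrow> 0 < x" if "b \<noteq> 0" for x b :: real
    using that by (auto simp: zero_less_mult_iff mult_less_0_iff linorder_neq_iff)
  then have sides: "?pt x y w \<in> side i (vertex j k) \<inter> side j (vertex i k) \<inter> side k (vertex i j) \<longleftrightarrow>
      0 < x \<and> 0 < y \<and> 0 < w" if "x + y + w = 1" for x y w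
    using that on off by (auto simp: side_def height_barycentric)
  have "affine hull (corners {i, j, k}) = UNIV"
    using corners_affine_independent card_corners by (intro affine_independent_span_eq) auto
  then have coordinates: "\<exists>x y w. x + y + w = 1 \<and> z = ?pt x y w" for z
    unfolding corners_triple affine_hull_3 by blast
  show ?thesis
  proof (rule set_eqI)
    fix z
    show "z \<in> open_triangle {i, j, k} \<longleftrightarrow>
        z \<in> side i (vertex j k) \<inter> side j (vertex i k) \<inter> side k (vertex i j)"
      using coordinates[of z] sides unfolding interior by blast
  qed
qed

lemma consecutive_iff_same_side:
  "consecutive i j k \<longleftrightarrow> (\<forall>l\<in>I - {i, j, k}. vertex i k \<in> side l (vertex i j))"
proof -
  have "consecutive i j k \<longleftrightarrow>
      (\<forall>l\<in>I - {i, j, k}. crossing i l \<notin> open_segment (crossing i j) (crossing i k))"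
    unfolding consecutive_def by (auto simp: open_segment_def)
  then show ?thesis using in_I distinct by (simp add: vertex_same_side_iff)
qed

lemma empty_triple_iff_consecutive:
  "{i, j, k} \<in> empty_triples \<longleftrightarrow> consecutive i j k \<and> consecutive j i k \<and> consecutive k i j"
proof -
  have "consecutive a b c \<longleftrightarrow> consecutive a c b" "consecutive a b b" for a b c
    by (simp_all add: consecutive_def open_segment_commute)
  then show ?thesis using in_I distinct by (auto simp: empty_triples_def)
qed

lemma touching_eq_if_closure_eq:
  assumes "closure F = convex hull (corners {i, j, k})"
  shows "touching F = {i, j, k}"
proof -
  have "touches (line l) F \<longleftrightarrow> l \<in> {i, j, k}" if "l \<in> I" for l
  proof -
    have "touches (line l) F \<longleftrightarrow> (\<exists>u\<in>corners {i, j, k}. corners {i, j, k} - {u} \<subseteq> line l)"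
      using corners_affine_independent card_corners assms affine_imp_convex[OF affine_line]
      by (intro touches_simplex_iff) auto
    also have "\<dots> \<longleftrightarrow> l \<in> {i, j, k}"
      using in_I distinct vertices_distinct vertices_distinct[symmetric] that
      by (auto simp: corners_triple insert_Diff_if vertex_in_line_iff)
    finally show ?thesis .
  qed
  then show ?thesis using in_I by (auto simp: touching_def)
qed

end

lemma
  assumes "S \<subseteq> I" "card S = 3"
  shows closure_open_triangle: "closure (open_triangle S) = convex hull (corners S)"
    and open_triangle_nonempty: "open_triangle S \<noteq> {}"
proof -
  obtain i j k where ijk: "S = {i, j, k}" "i \<in> I" "j \<in> I" "k \<in> I" "i \<noteq> j" "i \<noteq> k" "j \<noteq> k"
    using assms by (auto simp: card_3_iff)
  then show "open_triangle S \<noteq> {}"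
    using corners_affine_independent[of i j k] card_corners[of i j k]
    by (simp add: open_triangle_def interior_convex_hull_eq_empty)
  moreover have "finite (corners S)" using corners_triple ijk by simp
  ultimately show "closure (open_triangle S) = convex hull (corners S)"
    unfolding open_triangle_def
    by (simp add: convex_closure_interior compact_imp_closed finite_imp_compact_convex_hull)
qed

lemma empty_triple_iff_same_side:
  assumes "S \<subseteq> I" "card S = 3"
  shows "S \<in> empty_triples \<longleftrightarrow> (\<forall>l\<in>I - S. \<forall>x\<in>corners S. corners S \<subseteq> side l x)"
proof -
  obtain i j k where S: "S = {i, j, k}" and ijk: "i \<in> I" "j \<in> I" "k \<in> I" "i \<noteq> j" "i \<noteq> k" "j \<noteq> k"
    using assms by (auto simp: card_3_iff)
  have "S \<in> empty_triples \<longleftrightarrow> consecutive i j k \<and> consecutive j i k \<and> consecutive k i j"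
    unfolding S using ijk by (rule empty_triple_iff_consecutive)
  also have "\<dots> \<longleftrightarrow> (\<forall>l\<in>I - S. vertex i k \<in> side l (vertex i j) \<and>
      vertex j k \<in> side l (vertex i j) \<and> vertex j k \<in> side l (vertex i k))"
    using consecutive_iff_same_side[of i j k] consecutive_iff_same_side[of j i k]
      consecutive_iff_same_side[of k i j] vertex_commute[of i j] vertex_commute[of i k]
      vertex_commute[of j k] ijk
    by (simp add: S insert_commute ball_conj_distrib)
  also have "\<dots> \<longleftrightarrow> (\<forall>l\<in>I - S. \<forall>x\<in>corners S. corners S \<subseteq> side l x)"
  proof (rule ball_cong)
    fix l assume l: "l \<in> I - S"
    then have "height l (vertex i j) \<noteq> 0" "height l (vertex i k) \<noteq> 0" "height l (vertex j k) \<noteq> 0"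
      using vertex_in_line_iff ijk by (auto simp: S line_def)
    then show "(vertex i k \<in> side l (vertex i j) \<and> vertex j k \<in> side l (vertex i j) \<and>
        vertex j k \<in> side l (vertex i k)) \<longleftrightarrow> (\<forall>x\<in>corners S. corners S \<subseteq> side l x)"
      unfolding S corners_triple[OF ijk] by (auto simp: mem_side_iff)
  qed simp
  finally show ?thesis .
qed

lemma empty_triple_iff_disjoint:
  assumes "S \<subseteq> I" "card S = 3"
  shows "S \<in> empty_triples \<longleftrightarrow> (\<forall>l\<in>I. open_triangle S \<inter> line l = {})"
proof -
  obtain i j k where ijk: "S = {i, j, k}" "i \<in> I" "j \<in> I" "k \<in> I" "i \<noteq> j" "i \<noteq> k" "j \<noteq> k"
    using assms by (auto simp: card_3_iff)
  have "open_triangle S \<inter> line l = {}" if "l \<in> S" for l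
    using that side_disjoint_line unfolding ijk(1) open_triangle_eq_Int_sides[OF ijk(2-7)] by blast
  moreover have "(\<forall>x\<in>corners S. corners S \<subseteq> side l x) \<longleftrightarrow> open_triangle S \<inter> line l = {}"
    if l: "l \<in> I - S" for l
  proof
    assume same: "\<forall>x\<in>corners S. corners S \<subseteq> side l x"
    have "vertex i j \<in> corners S" using ijk by (auto simp: corners_def)
    then have "open_triangle S \<subseteq> side l (vertex i j)"
      using same hull_minimal[of "corners S" _ convex] convex_side interior_subset
      unfolding open_triangle_def by blast
    then show "open_triangle S \<inter> line l = {}" using side_disjoint_line by blast
  next
    assume "open_triangle S \<inter> line l = {}"
    moreover have "corners S \<inter> line l = {}"
      unfolding corners_triple[OF ijk(2-7), folded ijk(1)]
      using l ijk by (auto simp: vertex_in_line_iff)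
    moreover have "connected (open_triangle S \<union> corners S)"
    proof (rule connected_intermediate_closure)
      show "connected (open_triangle S)" by (simp add: open_triangle_def convex_connected)
      show "open_triangle S \<union> corners S \<subseteq> closure (open_triangle S)"
        using closure_subset[of "open_triangle S"] hull_subset[of "corners S" convex]
        by (simp add: closure_open_triangle[OF assms])
    qed simp
    ultimately show "\<forall>x\<in>corners S. corners S \<subseteq> side l x"
      using connected_subset_side[of "open_triangle S \<union> corners S" l] by blast
  qed
  ultimately show ?thesis
    unfolding empty_triple_iff_same_side[OF assms] by blast
qed

lemma bounded_triangular_face_if_empty:
  assumes S: "S \<in> empty_triples"
  shows "open_triangle S \<in> bounded_triangular_faces (line ` I)"
proof -
  have SI: "S \<subseteq> I" "card S = 3" using S by (auto simp: empty_triples_def)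
  obtain i j k where ijk: "S = {i, j, k}" "i \<in> I" "j \<in> I" "k \<in> I" "i \<noteq> j" "i \<noteq> k" "j \<noteq> k"
    using SI by (auto simp: card_3_iff)
  note sides = open_triangle_eq_Int_sides[OF ijk(2-7), folded ijk(1)]
  have disjoint: "open_triangle S \<inter> \<Union>(line ` I) = {}"
    using S empty_triple_iff_disjoint[OF SI] by blast
  have "D = open_triangle S"
    if "open_triangle S \<subseteq> D" "D \<subseteq> - \<Union>(line ` I)" "connected D" for D
  proof -
    obtain c where c: "c \<in> open_triangle S" using open_triangle_nonempty[OF SI] by blast
    then have "D \<subseteq> side i c \<inter> side j c \<inter> side k c"
      using that ijk connected_subset_side[OF that(3), of _ c] by blast
    also have "\<dots> \<subseteq> open_triangle S"
      using c unfolding sides by (auto simp: mem_side_iff)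
    finally show ?thesis using that(1) by blast
  qed
  then have "open_triangle S \<in> faces (line ` I)"
    unfolding faces_def in_components_maximal
    using open_triangle_nonempty[OF SI] disjoint
    by (auto simp: open_triangle_def intro!: convex_connected)
  moreover have "2 simplex closure (open_triangle S)"
    using closure_open_triangle[OF SI] corners_affine_independent card_corners ijk
    by (auto intro!: simplex_convex_hull)
  moreover from this have "bounded (open_triangle S)"
    by (meson bounded_subset closure_subset compact_imp_bounded compact_simplex)
  ultimately show ?thesis by (simp add: bounded_triangular_faces_def)
qed

lemma closure_triangular_faceE:
  assumes face: "F \<in> faces (line ` I)" and simplex: "2 simplex closure F"
  obtains S where "S \<subseteq> I" "card S = 3" "closure F = convex hull (corners S)"
proof -
  obtain C where C: "\<not> affine_dependent C" "card C = 3" "closure F = convex hull C"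
    using simplex by (auto simp: simplex_def)
  then obtain p q r where pqr: "C = {p, q, r}" "p \<noteq> q" "p \<noteq> r" "q \<noteq> r" by (auto simp: card_3_iff)
  have edge: "\<exists>i\<in>I. {a, b} \<subseteq> line i" if "c \<in> C" "C - {c} = {a, b}" "a \<noteq> b" for a b c
  proof -
    have "(convex hull {a, b}) facet_of closure F"
      unfolding C(3) facet_of_convex_hull_affine_independent[OF C(1)]
      using that by (intro conjI exI[of _ c]) simp_all
    then show ?thesis using face_edge_subset_line[OF face] that(3) by metis
  qed
  have "C - {p} = {q, r}" "C - {q} = {p, r}" "C - {r} = {p, q}" using pqr by auto
  then obtain i j k where
    on: "i \<in> I" "{q, r} \<subseteq> line i" "j \<in> I" "{p, r} \<subseteq> line j" "k \<in> I" "{p, q} \<subseteq> line k"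
    using edge[of p q r] edge[of q p r] edge[of r p q] pqr by auto
  have "\<not> {p, q, r} \<subseteq> line l" for l
    using affine_independent_not_subset_line[OF C(1)] C(2) pqr(1) by simp
  then have neq: "i \<noteq> j" "i \<noteq> k" "j \<noteq> k" using on by auto
  have "p = vertex j k" "q = vertex i k" "r = vertex i j"
    using mem_two_lines_iff[of j k p] mem_two_lines_iff[of i k q] mem_two_lines_iff[of i j r] on neq
    by auto
  then have "closure F = convex hull (corners {i, j, k})"
    using C(3) pqr(1) corners_triple on neq by simp
  then show thesis using on neq by (intro that[of "{i, j, k}"]) auto
qed

lemma bounded_triangular_faces_eq:
  "bounded_triangular_faces (line ` I) = open_triangle ` empty_triples"
proof
  show "bounded_triangular_faces (line ` I) \<subseteq> open_triangle ` empty_triples"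
  proof
    fix F assume "F \<in> bounded_triangular_faces (line ` I)"
    then have face: "F \<in> faces (line ` I)" and "2 simplex closure F"
      by (auto simp: bounded_triangular_faces_def)
    then obtain S where S: "S \<subseteq> I" "card S = 3" "closure F = convex hull (corners S)"
      using closure_triangular_faceE by blast
    then have "F = open_triangle S"
      using interior_closure_face[OF face] by (simp add: open_triangle_def)
    moreover from this have "S \<in> empty_triples"
      using face_disjoint_line[OF face] empty_triple_iff_disjoint[OF S(1,2)] by blast
    ultimately show "F \<in> open_triangle ` empty_triples" by blast
  qed
  show "open_triangle ` empty_triples \<subseteq> bounded_triangular_faces (line ` I)"
    using bounded_triangular_face_if_empty by blast
qed

lemma touching_open_triangle:
  assumes "S \<in> empty_triples"
  shows "touching (open_triangle S) = S"
proof -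
  have S: "S \<subseteq> I" "card S = 3" using assms by (auto simp: empty_triples_def)
  then obtain i j k where "S = {i, j, k}" "i \<in> I" "j \<in> I" "k \<in> I" "i \<noteq> j" "i \<noteq> k" "j \<noteq> k"
    by (auto simp: card_3_iff)
  then show ?thesis using touching_eq_if_closure_eq closure_open_triangle[OF S] by metis
qed

lemma inj_on_open_triangle: "inj_on open_triangle empty_triples"
  using touching_open_triangle by (rule inj_on_inverseI)

lemma card_bounded_triangular_faces:
  "card (bounded_triangular_faces (line ` I)) = card empty_triples"
  by (simp add: bounded_triangular_faces_eq card_image inj_on_open_triangle)

lemma card_touching_faces:
  assumes "i \<in> I"
  shows "card {F \<in> bounded_triangular_faces (line ` I). touches (line i) F} =
    card {S \<in> empty_triples. i \<in> S}"
proof -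
  have "touches (line i) (open_triangle S) \<longleftrightarrow> i \<in> S" if "S \<in> empty_triples" for S
    using touching_open_triangle[OF that] assms by (auto simp: touching_def)
  then have "{F \<in> bounded_triangular_faces (line ` I). touches (line i) F} =
      open_triangle ` {S \<in> empty_triples. i \<in> S}"
    by (auto simp: bounded_triangular_faces_eq)
  then show ?thesis
    using inj_on_subset[OF inj_on_open_triangle] by (simp add: card_image)
qed

end

section \<open>Counting triangles from the order of the crossings\<close>

definition adjacent_in :: "'a list \<Rightarrow> 'a \<Rightarrow> 'a \<Rightarrow> bool" where
  "adjacent_in xs x y \<longleftrightarrow> (x, y) \<in> set (zip xs (tl xs)) \<or> (y, x) \<in> set (zip xs (tl xs))"

lemma in_set_zip_tl_iff: "(x, y) \<in> set (zip xs (tl xs)) \<longleftrightarrow> (\<exists>us vs. xs = us @ x # y # vs)"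
proof (induction xs)
  case (Cons a xs)
  then show ?case by (cases xs) (auto simp: Cons_eq_append_conv)
qed simp

lemma zip_tl_sorted_iff:
  fixes f :: "'a \<Rightarrow> 'b::linorder"
  assumes sorted: "sorted_wrt (<) (map f xs)" and "x \<in> set xs" "y \<in> set xs"
  shows "(x, y) \<in> set (zip xs (tl xs)) \<longleftrightarrow> f x < f y \<and> (\<forall>z\<in>set xs. f z \<notin> {f x<..<f y})"
proof
  assume "(x, y) \<in> set (zip xs (tl xs))"
  then obtain us vs where "xs = us @ x # y # vs" by (auto simp: in_set_zip_tl_iff)
  then show "f x < f y \<and> (\<forall>z\<in>set xs. f z \<notin> {f x<..<f y})"
    using sorted by (auto simp: sorted_wrt_append)
next
  assume gap: "f x < f y \<and> (\<forall>z\<in>set xs. f z \<notin> {f x<..<f y})"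
  obtain us ws where xs: "xs = us @ x # ws" using \<open>x \<in> set xs\<close> by (auto dest: split_list)
  then have "y \<in> set ws" using sorted \<open>y \<in> set xs\<close> gap by (auto simp: sorted_wrt_append)
  then obtain z zs where ws: "ws = z # zs" by (cases ws) auto
  then have "y = z" using sorted \<open>y \<in> set ws\<close> gap by (auto simp: xs sorted_wrt_append)
  then show "(x, y) \<in> set (zip xs (tl xs))" unfolding in_set_zip_tl_iff xs ws by blast
qed

lemma inj_on_if_sorted_map: "sorted_wrt (<) (map f xs) \<Longrightarrow> inj_on f (set xs)"
  for f :: "'a \<Rightarrow> 'b::linorder"
  by (simp add: strict_sorted_iff distinct_map)

lemma sorted_map_if_successively: "successively (\<lambda>x y. f x < f y) xs \<Longrightarrow> sorted_wrt (<) (map f xs)"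
  for f :: "'a \<Rightarrow> 'b::linorder"
  by (subst (asm) successively_conv_sorted_wrt) (auto simp: sorted_wrt_map transp_def)

lemma adjacent_in_sorted_iff:
  fixes f :: "'a \<Rightarrow> real"
  assumes "sorted_wrt (<) (map f xs)" "x \<in> set xs" "y \<in> set xs" "x \<noteq> y"
  shows "adjacent_in xs x y \<longleftrightarrow> (\<forall>z\<in>set xs. f z \<notin> open_segment (f x) (f y))"
proof -
  have "f x \<noteq> f y" using inj_on_if_sorted_map[OF assms(1)] assms(2-4) by (auto dest: inj_onD)
  then show ?thesis
    unfolding adjacent_in_def zip_tl_sorted_iff[OF assms(1-3)] zip_tl_sorted_iff[OF assms(1,3,2)]
    by (auto simp: open_segment_eq_real_ivl)
qed

definition triangles_at :: "('a \<Rightarrow> 'a list) \<Rightarrow> 'a \<Rightarrow> ('a \<times> 'a) list" where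
  "triangles_at along i = filter (\<lambda>(j, k). adjacent_in (along j) i k \<and> adjacent_in (along k) i j)
     (zip (along i) (tl (along i)))"

locale sorted_line_family = line_family I s t for I :: "'i set" and s t +
  fixes along :: "'i \<Rightarrow> 'i list"
  assumes set_along: "i \<in> I \<Longrightarrow> set (along i) = I - {i}"
    and sorted_along: "i \<in> I \<Longrightarrow> sorted_wrt (<) (map (crossing i) (along i))"
begin

sublocale simple_line_family
  by unfold_locales (metis inj_on_if_sorted_map set_along sorted_along)

lemma adjacent_along_iff:
  assumes "i \<in> I" "j \<in> I" "k \<in> I" "i \<noteq> j" "i \<noteq> k" "j \<noteq> k"
  shows "adjacent_in (along i) j k \<longleftrightarrow> consecutive i j k"
  using adjacent_in_sorted_iff[OF sorted_along[OF assms(1)], of j k] assms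
  by (simp add: consecutive_def set_along)

lemma empty_tripleD:
  assumes "{i, j, k} \<in> empty_triples"
  shows "{i, j, k} \<subseteq> I" "distinct [i, j, k]"
  using assms card_distinct[of "[i, j, k]"] by (auto simp: empty_triples_def)

lemma mem_triangles_at_iff:
  assumes "i \<in> I"
  shows "(j, k) \<in> set (triangles_at along i) \<longleftrightarrow>
    {i, j, k} \<in> empty_triples \<and> crossing i j < crossing i k"
proof (cases "{j, k} \<subseteq> I - {i} \<and> j \<noteq> k")
  case True
  then show ?thesis
    using assms zip_tl_sorted_iff[OF sorted_along[OF assms], of j k]
    by (auto simp: triangles_at_def empty_triple_iff_consecutive adjacent_along_iff set_along
        consecutive_def open_segment_eq_real_ivl)
next
  case False
  have "{j, k} \<subseteq> I - {i} \<and> j \<noteq> k" if "(j, k) \<in> set (triangles_at along i)"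
  proof -
    from that have zip: "(j, k) \<in> set (zip (along i) (tl (along i)))"
      by (simp add: triangles_at_def)
    then have "j \<in> set (along i)" "k \<in> set (along i)" by (auto simp: in_set_zip_tl_iff)
    then show ?thesis
      using zip zip_tl_sorted_iff[OF sorted_along[OF assms]] set_along[OF assms] by auto
  qed
  moreover have "{j, k} \<subseteq> I - {i} \<and> j \<noteq> k" if "{i, j, k} \<in> empty_triples"
    using empty_tripleD[OF that] by auto
  ultimately show ?thesis using False by blast
qed

lemma card_empty_triples_containing:
  assumes "i \<in> I"
  shows "card {S \<in> empty_triples. i \<in> S} = length (triangles_at along i)"
proof -
  let ?triple = "\<lambda>(j, k). {i, j, k}"
  have "inj_on ?triple (set (triangles_at along i))"
  proof (rule inj_onI, clarify)
    fix j k j' k'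
    assume "(j, k) \<in> set (triangles_at along i)" "(j', k') \<in> set (triangles_at along i)"
      and eq: "{i, j, k} = {i, j', k'}"
    then have "i \<notin> {j, k}" "i \<notin> {j', k'}"
      "crossing i j < crossing i k" "crossing i j' < crossing i k'"
      using empty_tripleD(2)[of i j k] empty_tripleD(2)[of i j' k']
      by (auto simp: mem_triangles_at_iff[OF assms])
    then show "j = j' \<and> k = k'"
      using eq by (metis doubleton_eq_iff insert_ident order_less_asym)
  qed
  moreover have "?triple ` set (triangles_at along i) = {S \<in> empty_triples. i \<in> S}"
  proof (intro set_eqI iffI)
    fix S assume "S \<in> {S \<in> empty_triples. i \<in> S}"
    then have S: "S \<in> empty_triples" "S \<subseteq> I" "i \<in> S" "card (S - {i}) = 2"
      by (auto simp: empty_triples_def)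
    then obtain j k where jk: "S - {i} = {j, k}" "j \<noteq> k" unfolding card_2_iff by blast
    then have S_eq: "S = {i, j, k}" "S = {i, k, j}" using S(3) by blast+
    have "j \<in> I - {i}" "k \<in> I - {i}" using jk(1) S(2) by blast+
    then have "crossing i j \<noteq> crossing i k"
      using jk(2) inj_crossing[OF assms] by (blast dest: inj_onD)
    then consider "(j, k) \<in> set (triangles_at along i)" | "(k, j) \<in> set (triangles_at along i)"
      using S(1) unfolding mem_triangles_at_iff[OF assms] S_eq[symmetric] by linarith
    then show "S \<in> ?triple ` set (triangles_at along i)"
      by cases (use S_eq in force)+
  qed (auto simp: mem_triangles_at_iff[OF assms])
  moreover have "distinct (triangles_at along i)"
    using sorted_along[OF assms]
    by (simp add: triangles_at_def strict_sorted_iff distinct_map distinct_zipI1)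
  ultimately show ?thesis by (metis (no_types, lifting) card_image distinct_card)
qed

lemma sum_length_triangles_at: "(\<Sum>i\<in>I. length (triangles_at along i)) = 3 * card empty_triples"
proof -
  have "finite empty_triples"
    using finite_I by (auto simp: empty_triples_def intro: finite_subset[of _ "Pow I"])
  moreover have "card {i \<in> I. i \<in> S} = 3" if "S \<in> empty_triples" for S
    using that by (auto simp: empty_triples_def Int_absorb1 simp flip: Int_def)
  ultimately have "(\<Sum>i\<in>I. card {S \<in> empty_triples. i \<in> S}) = 3 * card empty_triples"
    using finite_I by (intro sum_multicount) auto
  then show ?thesis by (simp add: card_empty_triples_containing)
qed

end

section \<open>Interval arithmetic\<close>

text \<open>Lines are given as pairs of slope and offset. The type is polymorphic since the gap is
  evaluated at real numbers, for its meaning, and at intervals, for its sign.\<close>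

fun crossing_gap :: "'a::{plus,minus,times} \<times> 'a \<Rightarrow> 'a \<times> 'a \<Rightarrow> 'a \<times> 'a \<Rightarrow> 'a" where
  "crossing_gap (a, u) (b, v) (c, w) =
     (a - b) * (a - c) * (a * (w - v) + b * (u - w) + c * (v - u))"

lemma crossing_gap_scale:
  fixes a b c u v w \<alpha> \<beta> :: "'a::comm_ring_1"
  shows "crossing_gap (\<alpha> * a, \<beta> * u) (\<alpha> * b, \<beta> * v) (\<alpha> * c, \<beta> * w) =
    \<alpha> ^ 3 * \<beta> * crossing_gap (a, u) (b, v) (c, w)"
  by (simp add: power3_eq_cube algebra_simps)

lemma crossing_gap_pos_opposite_intercepts:
  fixes a b e :: "'a::linordered_idom"
  assumes "a < 0" "0 < b" "0 < e"
  shows "0 < crossing_gap (0, 0) (a, a * e) (b, - (b * e))"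
    and "0 < crossing_gap (a, a * e) (0, 0) (b, - (b * e))"
    and "0 < crossing_gap (b, - (b * e)) (a, a * e) (0, 0)"
proof -
  have "crossing_gap (0, 0) (a, a * e) (b, - (b * e)) = 2 * e * (a\<^sup>2 * b\<^sup>2)"
    and "crossing_gap (a, a * e) (0, 0) (b, - (b * e)) = 2 * e * (a\<^sup>2 * b * (b - a))"
    and "crossing_gap (b, - (b * e)) (a, a * e) (0, 0) = 2 * e * (- a * b\<^sup>2 * (b - a))"
    by (simp_all add: power2_eq_square algebra_simps)
  moreover have "0 < a\<^sup>2" "0 < b\<^sup>2" "0 < b - a" "0 < - a" using assms by auto
  ultimately show "0 < crossing_gap (0, 0) (a, a * e) (b, - (b * e))"
    and "0 < crossing_gap (a, a * e) (0, 0) (b, - (b * e))"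
    and "0 < crossing_gap (b, - (b * e)) (a, a * e) (0, 0)"
    using assms by (simp_all only: mult_pos_pos zero_less_numeral)
qed

lemma (in line_family) crossing_less_iff:
  assumes "i \<in> I" "j \<in> I - {i}" "k \<in> I - {i}"
  shows "crossing i j < crossing i k \<longleftrightarrow> 0 < crossing_gap (s i, t i) (s j, t j) (s k, t k)"
proof -
  have "s i - s j \<noteq> 0" "s i - s k \<noteq> 0" using assms slope_neq[of i] by auto
  then have difference: "crossing i k - crossing i j =
      (s i * (t k - t j) + s j * (t i - t k) + s k * (t j - t i)) / ((s i - s j) * (s i - s k))"
    by (simp add: crossing_def field_simps)
  have sign: "0 < x / y \<longleftrightarrow> 0 < y * x" for x y :: real
    by (auto simp: zero_less_divide_iff zero_less_mult_iff)
  have "crossing i j < crossing i k \<longleftrightarrow> 0 < crossing i k - crossing i j" by simp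
  also have "\<dots> \<longleftrightarrow> 0 < crossing_gap (s i, t i) (s j, t j) (s k, t k)"
    unfolding difference sign crossing_gap.simps by (rule refl)
  finally show ?thesis .
qed

lemma lower_Ivl [simp]: "a \<le> b \<Longrightarrow> lower (Ivl a b) = a"
  by (simp add: lower.rep_eq Ivl.rep_eq min_def)

lemma upper_Ivl [simp]: "upper (Ivl a b) = b"
  by (simp add: upper.rep_eq Ivl.rep_eq)

definition real_interval :: "int interval \<Rightarrow> real interval" where
  "real_interval X = Ivl (of_int (lower X)) (of_int (upper X))"

lemma lower_real_interval [simp]: "lower (real_interval X) = of_int (lower X)"
  by (simp add: real_interval_def)

lemma upper_real_interval [simp]: "upper (real_interval X) = of_int (upper X)"
  by (simp add: real_interval_def)

lemma real_interval_plus: "real_interval (X + Y) = real_interval X + real_interval Y"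
  by (rule interval_eqI) simp_all

lemma real_interval_uminus: "real_interval (- X) = - real_interval X"
  by (rule interval_eqI) simp_all

lemma real_interval_minus: "real_interval (X - Y) = real_interval X - real_interval Y"
  by (rule interval_eqI) simp_all

lemma real_interval_times: "real_interval (X * Y) = real_interval X * real_interval Y"
  by (rule interval_eqI) (simp_all add: lower_times upper_times of_int_min of_int_max)

definition encloses :: "int interval \<times> int interval \<Rightarrow> real \<times> real \<Rightarrow> bool" where
  "encloses B p \<longleftrightarrow> fst p \<in>\<^sub>i real_interval (fst B) \<and> snd p \<in>\<^sub>i real_interval (snd B)"

lemma crossing_gap_pos_if_encloses:
  assumes "encloses A p" "encloses B q" "encloses C r" "0 < lower (crossing_gap A B C)"
  shows "0 < crossing_gap p q r"
proof -
  have "crossing_gap p q r \<in>\<^sub>i real_interval (crossing_gap A B C)"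
    using assms(1-3) unfolding encloses_def
    by (cases A; cases B; cases C; cases p; cases q; cases r)
      (auto simp: real_interval_plus real_interval_minus real_interval_times
        intro!: times_in_intervalI plus_in_intervalI minus_in_intervalI)
  then have "of_int (lower (crossing_gap A B C)) \<le> crossing_gap p q r"
    by (simp add: set_of_eq)
  then show ?thesis using assms(4) by linarith
qed

section \<open>Bounds for the tangents\<close>

lemma arctan_sqrt_3: "arctan (sqrt 3) = pi / 3"
  by (rule arctan_unique[OF _ _ tan_60]) (use pi_gt_zero in linarith)+

lemma arctan_inverse_sqrt_3: "arctan (1 / sqrt 3) = pi / 6"
  by (rule arctan_unique[OF _ _ tan_30]) (use pi_gt_zero in linarith)+

lemma arctan_triple:
  assumes "\<bar>x\<bar> < 1 / sqrt 3"
  shows "3 * arctan x = arctan ((3 * x - x ^ 3) / (1 - 3 * x\<^sup>2))"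
proof -
  define y where "y = 2 * x / (1 - x\<^sup>2)"
  have range: "- (pi / 6) < arctan x" "arctan x < pi / 6"
    using assms arctan_less_iff[of x "1 / sqrt 3"] arctan_less_iff[of "- x" "1 / sqrt 3"]
    by (auto simp: arctan_minus arctan_inverse_sqrt_3)
  have "\<bar>x\<bar>\<^sup>2 < (1 / sqrt 3)\<^sup>2" using assms by (intro power_strict_mono) auto
  then have sq: "x\<^sup>2 < 1 / 3" by (simp add: power_divide)
  then have double: "2 * arctan x = arctan y" unfolding y_def
    by (intro arctan_double) (simp flip: abs_square_less_1)
  have "3 * arctan x = arctan ((y + x) / (1 - y * x))"
  proof (rule arctan_unique[symmetric])
    have "cos (arctan y + arctan x) > 0" using range double by (intro cos_gt_zero_pi) linarith+
    then have "tan (arctan y + arctan x) = (y + x) / (1 - y * x)"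
      using tan_add[of "arctan y" "arctan x"] by (simp add: tan_arctan)
    then show "tan (3 * arctan x) = (y + x) / (1 - y * x)" by (simp flip: double)
  qed (use range in linarith)+
  also have "(y + x) / (1 - y * x) = (3 * x - x ^ 3) / (1 - 3 * x\<^sup>2)"
  proof -
    have "y + x = (3 * x - x ^ 3) / (1 - x\<^sup>2)" "1 - y * x = (1 - 3 * x\<^sup>2) / (1 - x\<^sup>2)"
      using sq by (simp_all add: y_def field_simps power2_eq_square power3_eq_cube)
    then show ?thesis using sq by simp
  qed
  finally show ?thesis .
qed

lemma less_tan_iff: "0 < y \<Longrightarrow> y < pi / 2 \<Longrightarrow> x < tan y \<longleftrightarrow> arctan x < y"
  using arctan_less_iff[of x "tan y"] by (simp add: arctan_tan)

lemma tan_less_iff: "0 < y \<Longrightarrow> y < pi / 2 \<Longrightarrow> tan y < x \<longleftrightarrow> y < arctan x"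
  using arctan_less_iff[of "tan y" x] by (simp add: arctan_tan)

lemma sqrt_3_bounds: "1.73205 < sqrt 3" "sqrt 3 < 1.73206"
  by (rule real_less_rsqrt real_less_lsqrt; simp add: power2_eq_square)+

lemma tan_pi_9_bounds: "0.36395 < tan (pi / 9)" "tan (pi / 9) < 0.36398"
proof -
  have range: "\<bar>0.36395\<bar> < 1 / sqrt 3" "\<bar>0.36398\<bar> < 1 / sqrt 3"
    using sqrt_3_bounds by (simp_all add: field_simps)
  have "3 * arctan 0.36395 < arctan (sqrt 3)" "arctan (sqrt 3) < 3 * arctan 0.36398"
    unfolding arctan_triple[OF range(1)] arctan_triple[OF range(2)] arctan_less_iff
    using sqrt_3_bounds by (simp_all add: power2_eq_square power3_eq_cube)
  then show "0.36395 < tan (pi / 9)" "tan (pi / 9) < 0.36398"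
    using less_tan_iff[of "pi / 9" "0.36395"] tan_less_iff[of "pi / 9" "0.36398"]
    by (simp_all add: arctan_sqrt_3)
qed

lemma tan_pi_18_bounds: "0.17632 < tan (pi / 18)" "tan (pi / 18) < 0.17633"
proof -
  have range: "\<bar>0.17632\<bar> < 1 / sqrt 3" "\<bar>0.17633\<bar> < 1 / sqrt 3"
    using sqrt_3_bounds by (simp_all add: field_simps)
  have "3 * arctan 0.17632 < arctan (1 / sqrt 3)" "arctan (1 / sqrt 3) < 3 * arctan 0.17633"
    unfolding arctan_triple[OF range(1)] arctan_triple[OF range(2)] arctan_less_iff
    using sqrt_3_bounds by (simp_all add: power2_eq_square power3_eq_cube field_simps)
  then show "0.17632 < tan (pi / 18)" "tan (pi / 18) < 0.17633"
    using less_tan_iff[of "pi / 18" "0.17632"] tan_less_iff[of "pi / 18" "0.17633"]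
    by (simp_all add: arctan_inverse_sqrt_3)
qed

lemma tan_2pi_9_bounds: "0.839 < tan (2 * pi / 9)" "tan (2 * pi / 9) < 0.8392"
proof -
  have "arctan 0.839 < 2 * arctan 0.36395" "2 * arctan 0.36398 < arctan 0.8392"
    by (subst arctan_double, simp, subst arctan_less_iff, simp add: power2_eq_square)+
  moreover have "arctan 0.36395 < pi / 9" "pi / 9 < arctan 0.36398"
    using tan_pi_9_bounds less_tan_iff[of "pi / 9" "0.36395"] tan_less_iff[of "pi / 9" "0.36398"]
    by simp_all
  ultimately show "0.839 < tan (2 * pi / 9)" "tan (2 * pi / 9) < 0.8392"
    using less_tan_iff[of "2 * pi / 9" "0.839"] tan_less_iff[of "2 * pi / 9" "0.8392"] by simp_all
qed

lemma tan_multiples_bounds: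
  "tan (pi / 18) \<in> {0.176 .. 0.177}" "tan (2 * pi / 18) \<in> {0.363 .. 0.364}"
  "tan (3 * pi / 18) \<in> {0.577 .. 0.578}" "tan (4 * pi / 18) \<in> {0.839 .. 0.840}"
  "tan (5 * pi / 18) \<in> {1.191 .. 1.192}" "tan (6 * pi / 18) \<in> {1.732 .. 1.733}"
  "tan (7 * pi / 18) \<in> {2.747 .. 2.748}" "tan (8 * pi / 18) \<in> {5.671 .. 5.672}"
proof -
  have inverse_mono: "inverse x \<in> {inverse b .. inverse a}"
    if "0 < a" "a < x" "x < b" for a b x :: real
    using that by (auto intro!: le_imp_inverse_le)
  have complement: "tan (5 * pi / 18) = inverse (tan (2 * pi / 9))"
    "tan (7 * pi / 18) = inverse (tan (pi / 9))" "tan (8 * pi / 18) = inverse (tan (pi / 18))"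
    by (rule trans[OF _ tan_cot], rule arg_cong[of _ _ tan], linarith)+
  show "tan (pi / 18) \<in> {0.176 .. 0.177}" "tan (2 * pi / 18) \<in> {0.363 .. 0.364}"
    "tan (4 * pi / 18) \<in> {0.839 .. 0.840}"
    using tan_pi_18_bounds tan_pi_9_bounds tan_2pi_9_bounds by auto
  show "tan (5 * pi / 18) \<in> {1.191 .. 1.192}" "tan (7 * pi / 18) \<in> {2.747 .. 2.748}"
    "tan (8 * pi / 18) \<in> {5.671 .. 5.672}"
    unfolding complement using inverse_mono[OF _ tan_pi_18_bounds]
      inverse_mono[OF _ tan_pi_9_bounds] inverse_mono[OF _ tan_2pi_9_bounds] by auto
  show "tan (6 * pi / 18) \<in> {1.732 .. 1.733}" using sqrt_3_bounds by (simp add: tan_60)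
  have tan_3: "tan (3 * pi / 18) = 1 / sqrt 3" using tan_30 by simp
  show "tan (3 * pi / 18) \<in> {0.577 .. 0.578}"
    unfolding tan_3 using sqrt_3_bounds by (simp add: field_simps)
qed

section \<open>The arrangement of 19 lines\<close>

text \<open>The entries at \<open>i\<close> enclose the slope and the intercept of line \<open>i\<close> in units of \<open>10\<^sup>-\<^sup>3\<close>;
  line \<open>0\<close> is \<open>Y\<^sub>0\<close>, regarded as \<open>y = 0 (x - 0)\<close>.\<close>

definition slope_box :: "nat \<Rightarrow> int interval" where
  "slope_box i =
    [Ivl 0 0, Ivl (- 181) (- 179), Ivl (- 253) (- 252), Ivl (- 326) (- 325), Ivl (- 1746) (- 1745),
     Ivl (- 2180) (- 2179), Ivl (- 2796) (- 2795), Ivl (- 4596) (- 4595), Ivl (- 5673) (- 5671),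
     Ivl (- 7400) (- 7398), Ivl (- 23080) (- 23078), Ivl 4389 4391, Ivl 2901 2903, Ivl 1318 1319,
     Ivl 901 903, Ivl 844 846, Ivl 640 641, Ivl 443 445, Ivl 155 156] ! i"

definition intercept_box :: "nat \<Rightarrow> int interval" where
  "intercept_box i =
    [Ivl 0 0, Ivl (- 5672) (- 5671), Ivl (- 840) (- 839), Ivl (- 1733) (- 1732), Ivl 2747 2748,
     Ivl 176 177, Ivl 1191 1192, Ivl (- 1192) (- 1191), Ivl (- 1) 0, Ivl (- 364) (- 363),
     Ivl 577 578, Ivl (- 2748) (- 2747), Ivl (- 578) (- 577), Ivl 363 364, Ivl 839 840, Ivl 0 1,
     Ivl 1732 1733, Ivl (- 177) (- 176), Ivl 5671 5672] ! i"

definition line_box :: "nat \<Rightarrow> int interval \<times> int interval" where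
  "line_box i = (slope_box i, - (slope_box i * intercept_box i))"

text \<open>Row \<open>i\<close> lists the other lines in the order in which line \<open>i\<close> meets them from left to right;
  it was found numerically.\<close>

definition crossing_order :: "nat list list" where
  "crossing_order =
    [[1, 11, 3, 7, 2, 12, 9, 17, 8, 15, 5, 13, 10, 14, 6, 16, 4, 18],
     [0, 11, 17, 7, 15, 12, 18, 13, 14, 9, 16, 8, 10, 5, 6, 3, 4, 2],
     [3, 11, 7, 0, 12, 17, 9, 15, 8, 13, 5, 14, 10, 16, 6, 18, 4, 1],
     [2, 11, 0, 7, 17, 12, 15, 9, 13, 8, 14, 5, 16, 10, 18, 6, 1, 4],
     [5, 7, 6, 9, 8, 11, 10, 12, 13, 15, 14, 17, 16, 0, 18, 2, 1, 3],
     [4, 7, 11, 9, 12, 8, 17, 15, 0, 13, 2, 14, 3, 16, 18, 10, 1, 6],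
     [7, 4, 9, 11, 8, 12, 10, 15, 13, 17, 14, 0, 16, 2, 18, 3, 1, 5],
     [6, 4, 5, 11, 2, 0, 3, 17, 1, 15, 18, 12, 14, 13, 16, 9, 10, 8],
     [9, 4, 11, 6, 12, 5, 17, 0, 15, 2, 13, 3, 14, 18, 16, 1, 10, 7],
     [8, 4, 6, 11, 5, 12, 0, 17, 2, 15, 3, 13, 18, 14, 1, 16, 7, 10],
     [11, 4, 12, 6, 15, 17, 13, 0, 14, 2, 16, 3, 18, 5, 1, 8, 7, 9],
     [12, 13, 14, 16, 15, 18, 17, 1, 0, 3, 2, 7, 5, 9, 6, 8, 4, 10],
     [11, 13, 16, 14, 7, 18, 1, 15, 3, 17, 2, 0, 9, 5, 8, 6, 10, 4],
     [11, 12, 16, 7, 14, 1, 18, 9, 3, 8, 2, 5, 0, 10, 17, 6, 15, 4],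
     [11, 16, 12, 7, 13, 1, 9, 18, 8, 3, 5, 2, 10, 0, 6, 17, 4, 15],
     [16, 11, 18, 7, 1, 12, 3, 9, 2, 8, 0, 5, 17, 10, 6, 13, 4, 14],
     [15, 11, 14, 12, 13, 7, 9, 1, 8, 18, 5, 3, 10, 2, 6, 0, 4, 17],
     [18, 11, 1, 7, 3, 12, 2, 9, 0, 8, 5, 15, 10, 13, 6, 14, 4, 16],
     [17, 11, 15, 7, 12, 1, 13, 9, 14, 8, 16, 5, 10, 3, 6, 2, 4, 0]]"

text \<open>The gap of the three exceptional triples tends to \<open>0\<close> with \<open>\<epsilon>\<close>, so no enclosure of the
  parameters certifies its sign.\<close>

definition gap_certified :: "nat \<Rightarrow> nat \<Rightarrow> nat \<Rightarrow> bool" where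
  "gap_certified i j k \<longleftrightarrow> (i, j, k) \<in> {(0, 8, 15), (8, 0, 15), (15, 8, 0)} \<or>
     0 < lower (crossing_gap (line_box i) (line_box j) (line_box k))"

lemma crossing_order_certified:
  "i < 19 \<Longrightarrow> successively (gap_certified i) (crossing_order ! i)"
proof -
  have "list_all (\<lambda>i. successively (gap_certified i) (crossing_order ! i)) [0..<19]" by code_simp
  then show "i < 19 \<Longrightarrow> successively (gap_certified i) (crossing_order ! i)"
    by (simp add: list_all_iff)
qed

lemma set_crossing_order: "i < 19 \<Longrightarrow> set (crossing_order ! i) = {..<19} - {i}"
proof -
  have "list_all (\<lambda>i. set (crossing_order ! i) = set [0..<19] - {i}) [0..<19]" by code_simp
  then show "i < 19 \<Longrightarrow> set (crossing_order ! i) = {..<19} - {i}"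
    by (simp add: list_all_iff atLeast0LessThan)
qed

definition slope_order :: "nat list" where
  "slope_order = rev [0..<11] @ rev [11..<19]"

lemma set_slope_order: "set slope_order = {..<19}"
  by (auto simp: slope_order_def)

lemma slope_boxes_ordered:
  "successively (\<lambda>i j. upper (slope_box i) < lower (slope_box j)) slope_order"
  by code_simp

lemma length_triangles_at_crossing_order:
  "length (triangles_at ((!) crossing_order) 0) = 17"
  "(\<Sum>i\<leftarrow>[0..<19]. length (triangles_at ((!) crossing_order) i)) = 3 * 107"
  by code_simp+

locale admissible_parameters =
  fixes \<epsilon> :: real and m :: "nat \<Rightarrow> real"
  assumes eps: "\<epsilon> \<in> {0 <..< 1 / 10 ^ 4}"
    and slopes: "\<forall>i\<in>{1..18}. m i \<in> {slope_center i - 1 / 10 ^ 4 .. slope_center i + 1 / 10 ^ 4}"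
begin

definition slope :: "nat \<Rightarrow> real" where
  "slope i = (if i = 0 then 0 else m i)"

definition offset :: "nat \<Rightarrow> real" where
  "offset i = (if i = 0 then 0 else - (m i * intercept \<epsilon> i))"

lemma slope_in_box:
  assumes "i < 19"
  shows "10 ^ 3 * slope i \<in>\<^sub>i real_interval (slope_box i)"
proof (cases "i = 0")
  case False
  then have "m i \<in> {slope_center i - 1 / 10 ^ 4 .. slope_center i + 1 / 10 ^ 4}" "i \<in> set [1..<19]"
    using slopes assms by auto
  then show ?thesis
    by (auto simp: upt_rec set_of_eq slope_box_def slope_def slope_center_def)
qed (simp add: set_of_eq slope_box_def slope_def)

lemma intercept_in_box:
  assumes "1 \<le> i" "i < 19"
  shows "10 ^ 3 * intercept \<epsilon> i \<in>\<^sub>i real_interval (intercept_box i)"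
proof -
  have "i \<in> set [1..<19]" using assms by simp
  then show ?thesis
    using eps tan_multiples_bounds
    by (auto simp: upt_rec set_of_eq intercept_box_def intercept_def)
qed

lemma line_box_encloses:
  assumes "i < 19"
  shows "encloses (line_box i) (10 ^ 3 * slope i, 10 ^ 6 * offset i)"
proof -
  define a where "a = (if i = 0 then 0 else intercept \<epsilon> i)"
  have "10 ^ 3 * a \<in>\<^sub>i real_interval (intercept_box i)"
    using intercept_in_box[of i] assms by (simp add: a_def set_of_eq intercept_box_def)
  then have "- ((10 ^ 3 * slope i) * (10 ^ 3 * a)) \<in>\<^sub>i
      real_interval (- (slope_box i * intercept_box i))"
    unfolding real_interval_uminus real_interval_times
    by (intro uminus_in_intervalI times_in_intervalI slope_in_box assms)
  also have "- ((10 ^ 3 * slope i) * (10 ^ 3 * a)) = 10 ^ 6 * offset i"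
    by (simp add: slope_def offset_def a_def)
  finally show ?thesis
    using slope_in_box[OF assms] by (simp add: encloses_def line_box_def)
qed

lemma inj_on_slope: "inj_on slope {..<19}"
proof -
  have "slope i < slope j"
    if "i \<in> set slope_order" "j \<in> set slope_order"
      and "upper (slope_box i) < lower (slope_box j)" for i j
  proof -
    have "10 ^ 3 * slope i < 10 ^ 3 * slope j"
      using that slope_in_box[of i] slope_in_box[of j] by (auto simp: set_of_eq set_slope_order)
    then show ?thesis by simp
  qed
  then have "successively (\<lambda>i j. slope i < slope j) slope_order"
    using slope_boxes_ordered by (rule successively_mono[rotated])
  then have "inj_on slope (set slope_order)"
    by (intro inj_on_if_sorted_map sorted_map_if_successively)
  then show ?thesis by (simp add: set_slope_order)
qed

sublocale line_family "{..<19}" slope offset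
  by unfold_locales (simp_all add: inj_on_slope)

lemma crossing_gap_pos_if_certified:
  assumes "i < 19" "j < 19" "k < 19" "gap_certified i j k"
  shows "0 < crossing_gap (slope i, offset i) (slope j, offset j) (slope k, offset k)"
proof (cases "(i, j, k) \<in> {(0, 8, 15), (8, 0, 15), (15, 8, 0)}")
  case True
  have "m 8 < 0" "0 < m 15" "0 < \<epsilon>"
    using bspec[OF slopes, of 8] bspec[OF slopes, of 15] eps by (auto simp: slope_center_def)
  note gaps = crossing_gap_pos_opposite_intercepts[OF this]
  have "slope 0 = 0" "offset 0 = 0" "slope 8 = m 8" "offset 8 = m 8 * \<epsilon>"
    "slope 15 = m 15" "offset 15 = - (m 15 * \<epsilon>)"
    by (simp_all add: slope_def offset_def intercept_def)
  then show ?thesis using True gaps by (auto simp del: crossing_gap.simps)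
next
  case False
  then have "0 < crossing_gap (10 ^ 3 * slope i, 10 ^ 6 * offset i)
      (10 ^ 3 * slope j, 10 ^ 6 * offset j) (10 ^ 3 * slope k, 10 ^ 6 * offset k)"
    using assms line_box_encloses
    by (intro crossing_gap_pos_if_encloses[of "line_box i" _ "line_box j" _ "line_box k"])
      (auto simp: gap_certified_def)
  then show ?thesis by (simp add: crossing_gap_scale zero_less_mult_iff del: crossing_gap.simps)
qed

sublocale sorted_line_family "{..<19}" slope offset "(!) crossing_order"
proof
  fix i :: nat assume "i \<in> {..<19}"
  then have i: "i < 19" by simp
  show "set (crossing_order ! i) = {..<19} - {i}" using i by (rule set_crossing_order)
  have "crossing i j < crossing i k"
    if "j \<in> set (crossing_order ! i)" "k \<in> set (crossing_order ! i)" "gap_certified i j k" for j k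
    using that i set_crossing_order[OF i] crossing_gap_pos_if_certified[of i j k]
    by (simp add: crossing_less_iff del: crossing_gap.simps)
  then have "successively (\<lambda>j k. crossing i j < crossing i k) (crossing_order ! i)"
    using crossing_order_certified[OF i] by (rule successively_mono[rotated])
  then show "sorted_wrt (<) (map (crossing i) (crossing_order ! i))"
    by (rule sorted_map_if_successively)
qed

lemma line_0: "line 0 = Y0"
  by (auto simp: line_def height_def Y0_def slope_def offset_def)

lemma arrangement_eq_lines: "arrangement \<epsilon> m = line ` {..<19}"
proof -
  have "line i = L \<epsilon> m i" if "i \<in> {1..18}" for i
    using that by (auto simp: line_def height_def L_def slope_def offset_def algebra_simps)
  moreover have "{..<19::nat} = insert 0 {1..18}" by auto
  ultimately show ?thesis by (simp add: arrangement_def line_0)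
qed

lemma card_triangular_faces_touching_Y0:
  "card {F \<in> bounded_triangular_faces (arrangement \<epsilon> m). touches Y0 F} = 17"
  using card_touching_faces[of 0] card_empty_triples_containing[of 0]
  by (simp add: arrangement_eq_lines line_0 length_triangles_at_crossing_order)

lemma card_triangular_faces: "card (bounded_triangular_faces (arrangement \<epsilon> m)) = 107"
proof -
  have "(\<Sum>i<19. length (triangles_at ((!) crossing_order) i)) = 3 * 107"
    using length_triangles_at_crossing_order(2)
    by (simp only: interv_sum_list_conv_sum_set_nat set_upt atLeast0LessThan)
  then show ?thesis
    using sum_length_triangles_at by (simp add: arrangement_eq_lines card_bounded_triangular_faces)
qed

end

lemma intercept_image:
  "intercept \<epsilon> ` {1..18} =
    (\<Union>k\<in>{1..8::nat}. {tan (real k * pi / 18), - tan (real k * pi / 18)}) \<union> {- \<epsilon>, \<epsilon>}"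
proof -
  have "{1..18} = set [1..<19::nat]" "{1..8} = set [1..<9::nat]" by auto
  then show ?thesis by (simp only:) (auto simp: upt_rec intercept_def)
qed

theorem theorem4p1:
  fixes \<epsilon> :: real and m :: "nat \<Rightarrow> real"
  assumes "\<epsilon> \<in> {0 <..< 1 / 10 ^ 4}"
    and "\<forall>i\<in>{1..18}. m i \<in> {slope_center i - 1 / 10 ^ 4 .. slope_center i + 1 / 10 ^ 4}"
  shows "simple_arrangement (arrangement \<epsilon> m) \<and> card (arrangement \<epsilon> m) = 19
    \<and> Y0 = {(x, y). y = 0}
    \<and> (\<forall>i\<in>{1..18}. L \<epsilon> m i = {(x, y). y = m i * (x - intercept \<epsilon> i)})
    \<and> (intercept \<epsilon> ` {1..18} =
         (\<Union>k\<in>{1..8::nat}. {tan (real k * pi / 18), - tan (real k * pi / 18)}) \<union> {- \<epsilon>, \<epsilon>}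
       \<and> \<epsilon> < 1 / 36)
    \<and> card {F \<in> bounded_triangular_faces (arrangement \<epsilon> m). touches Y0 F} = 17
    \<and> card (bounded_triangular_faces (arrangement \<epsilon> m)) = 107"
proof -
  interpret admissible_parameters \<epsilon> m
    using assms by unfold_locales
  have "simple_arrangement (arrangement \<epsilon> m)" "card (arrangement \<epsilon> m) = 19"
    using simple_arrangement_lines
    by (simp_all add: arrangement_eq_lines card_image[OF inj_on_line])
  moreover have "\<epsilon> < 1 / 36" using assms(1) by auto
  moreover have "\<forall>i\<in>{1..18}. L \<epsilon> m i = {(x, y). y = m i * (x - intercept \<epsilon> i)}"
    by (simp add: L_def)
  ultimately show ?thesis
    using Y0_def intercept_image card_triangular_faces_touching_Y0 card_triangular_faces
    by (intro conjI)
qed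

end
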